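(* Let $\mathcal{A}\subset\mathbb{P}^n$ be any set of $d$ hyperplanes. Consider a hyperplane $H$ of $\mathbb{P}^n$ that is defined by a linear form $x\in S$ and is not in $\mathcal{A}$. If $H$ contains at most one subspace $P\in S(\mathcal{A})$, then the general residual of $\mathcal{A}+H=\mathcal{A}\cup\{H\}$ is a basic double link of $r_{\mathcal{A}}$, that is, $$r_{\mathcal{A}+H}=x\cdot r_{\mathcal{A}}+(p),$$ where $p\in r_{\mathcal{A}}$ is a form of degree $|\mathcal{A}\cap H|$, $\mathcal{A}\cap H$ denotes the set of codimension two subspaces $H'\cap H$ with $H'\in\mathcal{A}$, and $x,p$ is a regular sequence.
   Context: $K$ is a field of characteristic zero, $n\ge2$, $S=K[x_0,\dots,x_n]$ with the standard grading. A hyperplane arrangement $\mathcal{A}\subset\mathbb{P}^n$ is a finite nonempty set of distinct hyperplanes, and $f_{\mathcal{A}}$ is the product of linear forms defining them; $\mathrm{Jac}(f_{\mathcal{A}})$ is the ideal generated by its first partial derivatives. $S(\mathcal{A})=\{H\cap H':H\neq H'\in\mathcal{A}\}$. For a linear form $\ell=\sum a_ix_i$, put $\frac{\partial f}{\partial\ell}=\sum_i a_i\frac{\partial f}{\partial x_i}$. For a general $\ell$ (in a suitable nonempty Zariski-open subset of $[S]_1$), the general residual of $\mathcal{A}$ with respect to $\ell$ is $r_{\mathcal{A}}=(f_{\mathcal{A}},\frac{\partial f_{\mathcal{A}}}{\partial\ell}):\mathrm{Jac}(f_{\mathcal{A}})$. The residuals $r_{\mathcal{A}}$ and $r_{\mathcal{A}+H}$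 are taken with respect to the same general $\ell$. *)

theory Defs
  imports
    "HOL-Analysis.Cartesian_Space"
    "HOL-Library.Poly_Mapping"
    "HOL-Library.Set_Algebras"
begin

text \<open>
  The polynomial ring \<open>S = K[x\<^sub>0, \<dots>, x\<^sub>n]\<close> is the monoid algebra of the free commutative monoid
  \<open>'n \<Rightarrow>\<^sub>0 nat\<close> of monomials, the variables being indexed by a finite type \<open>'n\<close> with \<open>n + 1\<close> elements.
\<close>

type_synonym ('k, 'n) mpoly = "('n \<Rightarrow>\<^sub>0 nat) \<Rightarrow>\<^sub>0 'k"

definition Var_exp :: "'n \<Rightarrow> ('n \<Rightarrow>\<^sub>0 nat)" where
  "Var_exp i = Poly_Mapping.single i 1"

definition forms :: "nat \<Rightarrow> ('k::field, 'n::finite) mpoly set" where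
  "forms k = {f. \<forall>m \<in> Poly_Mapping.keys f. (\<Sum>i\<in>UNIV. Poly_Mapping.lookup m i) = k}"

definition eval_at :: "('k::field, 'n::finite) mpoly \<Rightarrow> 'k ^ 'n \<Rightarrow> 'k" where
  "eval_at f v = (\<Sum>m \<in> Poly_Mapping.keys f. Poly_Mapping.lookup f m * (\<Prod>i\<in>UNIV. (v $ i) ^ Poly_Mapping.lookup m i))"

text \<open>The truncated subtraction in the exponent is harmless: the affected terms have coefficient \<open>0\<close>.\<close>

definition pderiv_var :: "'n \<Rightarrow> ('k::field, 'n::finite) mpoly \<Rightarrow> ('k, 'n) mpoly" where
  "pderiv_var i f =
     (\<Sum>m \<in> Poly_Mapping.keys f. Poly_Mapping.single (m - Var_exp i) (of_nat (Poly_Mapping.lookup m i) * Poly_Mapping.lookup f m))"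

definition lin_coeffs :: "('k::field, 'n::finite) mpoly \<Rightarrow> 'k ^ 'n" where
  "lin_coeffs l = (\<chi> i. Poly_Mapping.lookup l (Var_exp i))"

definition dir_deriv :: "('k::field, 'n::finite) mpoly \<Rightarrow> ('k, 'n) mpoly \<Rightarrow> ('k, 'n) mpoly" where
  "dir_deriv l f = (\<Sum>i\<in>UNIV. Poly_Mapping.single 0 (lin_coeffs l $ i) * pderiv_var i f)"

text \<open>Ideals of a commutative ring are the submodules of the ring as a module over itself.\<close>

global_interpretation ideal: module "(*) :: 'a::comm_ring_1 \<Rightarrow> 'a \<Rightarrow> 'a"
  defines ideal_gen = ideal.span
  by standard (simp_all add: algebra_simps)

definition colon :: "'a::comm_ring_1 set \<Rightarrow> 'a set \<Rightarrow> 'a set" where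
  "colon I J = {g. \<forall>h \<in> J. g * h \<in> I}"

definition regular_sequence :: "'a::comm_ring_1 list \<Rightarrow> bool" where
  "regular_sequence fs \<longleftrightarrow>
     (\<forall>i < length fs. \<forall>g. g * fs ! i \<in> ideal_gen (set (take i fs)) \<longrightarrow> g \<in> ideal_gen (set (take i fs)))
     \<and> ideal_gen (set fs) \<noteq> UNIV"

definition jacobian_ideal :: "('k::field, 'n::finite) mpoly \<Rightarrow> ('k, 'n) mpoly set" where
  "jacobian_ideal f = ideal_gen (range (\<lambda>i. pderiv_var i f))"

text \<open>
  Points of \<open>\<P>\<^sup>n\<close> are the lines through the origin of \<open>K\<^sup>n\<^sup>+\<^sup>1\<close>. The locus below is meant for
  homogeneous \<open>f\<close>, for which vanishing does not depend on the representative \<open>v\<close>.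
\<close>

type_synonym ('k, 'n) proj_point = "('k ^ 'n) set"

definition proj_zeros :: "('k::field, 'n::finite) mpoly \<Rightarrow> ('k, 'n) proj_point set" where
  "proj_zeros f = {vec.span {v} | v. v \<noteq> 0 \<and> eval_at f v = 0}"

definition defines_hyperplane ::
    "('k::field, 'n::finite) mpoly \<Rightarrow> ('k, 'n) proj_point set \<Rightarrow> bool" where
  "defines_hyperplane l H \<longleftrightarrow> l \<in> forms 1 \<and> l \<noteq> 0 \<and> H = proj_zeros l"

definition arrangement :: "('k::field, 'n::finite) proj_point set set \<Rightarrow> bool" where
  "arrangement A \<longleftrightarrow> finite A \<and> A \<noteq> {} \<and> (\<forall>H \<in> A. \<exists>l. defines_hyperplane l H)"

text \<open>
  A hyperplane determines its linear form, and hence an arrangement its defining polynomial, only up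
  to a nonzero scalar. The choice made here is immaterial: the ideals built from it do not depend on it.
\<close>

definition defining_form :: "('k::field, 'n::finite) proj_point set \<Rightarrow> ('k, 'n) mpoly" where
  "defining_form H = (SOME l. defines_hyperplane l H)"

definition arr_poly :: "('k::field, 'n::finite) proj_point set set \<Rightarrow> ('k, 'n) mpoly" where
  "arr_poly A = (\<Prod>H\<in>A. defining_form H)"

definition pairwise_meets ::
    "('k::field, 'n::finite) proj_point set set \<Rightarrow> ('k, 'n) proj_point set set" where
  "pairwise_meets A = {H \<inter> H' | H H'. H \<in> A \<and> H' \<in> A \<and> H \<noteq> H'}"

definition restriction ::
    "('k::field, 'n::finite) proj_point set set \<Rightarrow> ('k, 'n) proj_point set
      \<Rightarrow> ('k, 'n) proj_point set set" where
  "restriction A H = {H' \<inter> H | H'. H' \<in> A}"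

definition residual ::
    "('k::field, 'n::finite) mpoly \<Rightarrow> ('k, 'n) proj_point set set \<Rightarrow> ('k, 'n) mpoly set" where
  "residual l A =
     colon (ideal_gen {arr_poly A, dir_deriv l (arr_poly A)}) (jacobian_ideal (arr_poly A))"

text \<open>
  Zariski-open subsets of the affine space of linear forms, with the coefficients of the form as
  coordinates; \<open>F\<close> is a set of (not necessarily homogeneous) polynomials in these coordinates.
\<close>

definition zariski_open_forms1 :: "('k::field, 'n::finite) mpoly set \<Rightarrow> bool" where
  "zariski_open_forms1 U \<longleftrightarrow>
     (\<exists>F :: ('k, 'n) mpoly set. U = {l \<in> forms 1. \<exists>g \<in> F. eval_at g (lin_coeffs l) \<noteq> 0})"

text \<open>``\<open>P\<close> holds for a general linear form''.\<close>

definition for_general_linear_form :: "(('k::field, 'n::finite) mpoly \<Rightarrow> bool) \<Rightarrow> bool" where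
  "for_general_linear_form P \<longleftrightarrow>
     (\<exists>U. zariski_open_forms1 U \<and> U \<noteq> {} \<and> (\<forall>l \<in> U. P l))"

end

theory Submission
  imports Defs "HOL-Computational_Algebra.Factorial_Ring"
begin

text \<open>
  Let \<open>a\<close> be the direction of \<open>\<ell>\<close> and normalise the linear forms \<open>\<lambda>\<^sub>j\<close> of the arrangement by
  \<open>\<lambda>\<^sub>j(a) = 1\<close>. Then \<open>g\<close> lies in the residual iff for each \<open>i\<close> some \<open>v\<close> satisfies
  \<open>v \<equiv> (\<partial>\<^sub>i \<lambda>\<^sub>j) g\<close> modulo \<open>\<lambda>\<^sub>j\<close> for all \<open>j\<close>. For the arrangement enlarged by \<open>x\<close>, with \<open>x(a) = 1\<close>,
  subtracting congruences shows that each \<open>z\<^sub>j = \<lambda>\<^sub>j - x\<close> divides \<open>g\<close> modulo \<open>x\<close>. By hypothesis at most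
  one class of the \<open>z\<^sub>j\<close> up to scalars has several members; let \<open>z\<^sub>0\<close> represent it and let \<open>T\<close> be the set of the
  hyperplanes outside this class. Then \<open>p = z\<^sub>0 \<Prod>\<^sub>T \<lambda>\<^sub>j\<close> lies in the enlarged residual, and the
  divisibilities say precisely that \<open>g\<close> lies in \<open>(x, p)\<close>. If \<open>g = x r + q p\<close>, then dividing the congruences
  for \<open>x r\<close> by \<open>x\<close> shows that \<open>r\<close> lies in the original residual.
\<close>

subsection \<open>Substitutions and derivations\<close>

text \<open>This simp rule, which comes from the interpretation, loops together with associativity.\<close>

declare ideal.scale_scale [simp del]

lemma sum_single_lookup:
  "(\<Sum>m \<in> Poly_Mapping.keys f. Poly_Mapping.single m (Poly_Mapping.lookup f m)) = f"
  by (rule poly_mapping_eqI) (auto simp: lookup_sum lookup_single when_def in_keys_iff)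

lemma poly_mapping_additive_induct [case_names single add]:
  fixes f :: "'m \<Rightarrow>\<^sub>0 'k::comm_monoid_add"
  assumes "\<And>m a. P (Poly_Mapping.single m a)" and "\<And>f g. P f \<Longrightarrow> P g \<Longrightarrow> P (f + g)"
  shows "P f"
proof -
  have "P (\<Sum>m \<in> M. Poly_Mapping.single m (Poly_Mapping.lookup f m))" if "finite M" for M
    using that
  proof (induction M rule: finite_induct)
    case empty
    show ?case using assms(1)[of undefined 0] by simp
  qed (simp add: assms)
  from this[of "Poly_Mapping.keys f"] show ?thesis
    by (simp add: sum_single_lookup)
qed

lemma sum_single: "(\<Sum>i\<in>I. Poly_Mapping.single m (h i)) = Poly_Mapping.single m (\<Sum>i\<in>I. h i)"
  by (induction I rule: infinite_finite_induct) (simp_all add: single_add)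

text \<open>One substitution theory serves two coefficient maps: constants embedded in a polynomial
  ring, which gives ring maps between polynomial rings, and the identity of the field, which gives
  evaluation at a point.\<close>

locale coefficient_hom =
  fixes c :: "'k::field \<Rightarrow> 'r::comm_ring_1"
  assumes c_add: "c (a + b) = c a + c b"
    and c_mult: "c (a * b) = c a * c b"
    and c_one: "c 1 = 1"
begin

lemma c_zero: "c 0 = 0"
  using c_add[of 0 0] by simp

definition msubst :: "('n::finite \<Rightarrow> 'r) \<Rightarrow> ('k, 'n) mpoly \<Rightarrow> 'r" where
  "msubst \<phi> f = (\<Sum>m \<in> Poly_Mapping.keys f.
     c (Poly_Mapping.lookup f m) * (\<Prod>i\<in>UNIV. \<phi> i ^ Poly_Mapping.lookup m i))"

lemma msubst_add: "msubst \<phi> (f + g) = msubst \<phi> f + msubst \<phi> g"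
  unfolding msubst_def
  by (rule setsum_keys_plus_distrib[where f = "\<lambda>m a. c a * (\<Prod>i\<in>UNIV. \<phi> i ^ Poly_Mapping.lookup m i)"])
    (simp_all add: c_zero c_add algebra_simps)

lemma msubst_single:
  "msubst \<phi> (Poly_Mapping.single m a) = c a * (\<Prod>i\<in>UNIV. \<phi> i ^ Poly_Mapping.lookup m i)"
  by (cases "a = 0") (simp_all add: msubst_def c_zero)

lemma msubst_mult: "msubst \<phi> (f * g) = msubst \<phi> f * msubst \<phi> g"
proof (induction f rule: poly_mapping_additive_induct)
  case (single m a)
  show ?case
  proof (induction g rule: poly_mapping_additive_induct)
    case (single m' b)
    show ?case
      by (simp add: mult_single msubst_single c_mult lookup_add power_add prod.distrib)
  qed (simp add: msubst_add distrib_left)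
qed (simp add: msubst_add distrib_right)

lemma msubst_one: "msubst \<phi> 1 = 1"
  using msubst_single[of \<phi> 0 1] by (simp add: c_one)

lemma msubst_prod: "msubst \<phi> (\<Prod>i\<in>I. f i) = (\<Prod>i\<in>I. msubst \<phi> (f i))"
  by (induction I rule: infinite_finite_induct) (simp_all add: msubst_one msubst_mult)

lemma msubst_const: "msubst \<phi> (Poly_Mapping.single 0 a) = c a"
  by (simp add: msubst_single)

lemma msubst_Var: "msubst \<phi> (Poly_Mapping.single (Var_exp i) a) = c a * \<phi> i"
proof -
  have "(\<Prod>j\<in>UNIV. \<phi> j ^ Poly_Mapping.lookup (Var_exp i) j) = (\<Prod>j\<in>UNIV. if j = i then \<phi> i else 1)"
    by (rule prod.cong) (auto simp: Var_exp_def lookup_single)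
  then show ?thesis by (simp add: msubst_single)
qed

end

interpretation const_hom: coefficient_hom "Poly_Mapping.single (0 :: 'm::comm_monoid_add)"
  by standard (simp_all add: single_add mult_single)

interpretation id_hom: coefficient_hom "\<lambda>a :: 'k::field. a"
  by standard simp_all

lemma eval_at_eq_msubst: "eval_at f v = id_hom.msubst (($) v) f"
  by (simp add: eval_at_def id_hom.msubst_def)

lemma prod_single_one:
  "finite I \<Longrightarrow> (\<Prod>i\<in>I. Poly_Mapping.single (m i) (1::'k::field)) = Poly_Mapping.single (\<Sum>i\<in>I. m i :: 'm::comm_monoid_add) 1"
  by (induction I rule: finite_induct) (simp_all add: mult_single)

lemma single_one_power:
  "Poly_Mapping.single (Poly_Mapping.single i 1) (1::'k::field) ^ e = Poly_Mapping.single (Poly_Mapping.single i e) 1"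
  by (induction e) (simp_all add: mult_single single_add[symmetric])

text \<open>
  The library makes the polynomials in linearly ordered variables a domain; a polynomial ring over a
  finite index type embeds into one of these by numbering the variables.
\<close>

lemma mpoly_no_zero_divisors:
  fixes f g :: "('k::field, 'n::finite) mpoly"
  assumes "f * g = 0"
  shows "f = 0 \<or> g = 0"
proof -
  obtain num :: "'n \<Rightarrow> nat" where num: "inj num"
    using finite_imp_inj_to_nat_seg[of "UNIV :: 'n set"] by auto
  define T :: "('k, 'n) mpoly \<Rightarrow> (nat \<Rightarrow>\<^sub>0 nat) \<Rightarrow>\<^sub>0 'k" where
    "T = const_hom.msubst (\<lambda>i. Poly_Mapping.single (Poly_Mapping.single (num i) 1) 1)"
  define e :: "('n \<Rightarrow>\<^sub>0 nat) \<Rightarrow> (nat \<Rightarrow>\<^sub>0 nat)" where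
    "e m = (\<Sum>i\<in>UNIV. Poly_Mapping.single (num i) (Poly_Mapping.lookup m i))" for m
  have lookup_e: "Poly_Mapping.lookup (e m) (num i) = Poly_Mapping.lookup m i" for m i
    using num by (simp add: e_def lookup_sum lookup_single when_def inj_eq)
  have "inj e"
    by (rule injI) (metis lookup_e poly_mapping_eqI)
  have T: "T h = (\<Sum>m\<in>Poly_Mapping.keys h. Poly_Mapping.single (e m) (Poly_Mapping.lookup h m))" for h
    by (simp add: T_def const_hom.msubst_def single_one_power prod_single_one mult_single e_def del: One_nat_def)
  have lookup_T: "Poly_Mapping.lookup (T h) (e m) = Poly_Mapping.lookup h m" for h m
    using \<open>inj e\<close> by (auto simp: T lookup_sum lookup_single when_def inj_eq in_keys_iff)
  have T0: "h = 0" if "T h = 0" for h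
    using lookup_T[of h] that by (intro poly_mapping_eqI) simp
  have "T f * T g = T (f * g)"
    by (simp add: T_def const_hom.msubst_mult)
  also have "\<dots> = 0"
    by (simp add: assms T_def const_hom.msubst_def)
  finally show ?thesis
    using T0 by auto
qed

section \<open>Partial and directional derivatives\<close>

lemma pderiv_var_add: "pderiv_var i (f + g) = pderiv_var i f + pderiv_var i g"
  unfolding pderiv_var_def
  by (rule setsum_keys_plus_distrib[where f =
        "\<lambda>m a. Poly_Mapping.single (m - Var_exp i) (of_nat (Poly_Mapping.lookup m i) * a)"])
    (simp_all add: algebra_simps single_add)

lemma pderiv_var_single:
  "pderiv_var i (Poly_Mapping.single m a) =
     Poly_Mapping.single (m - Var_exp i) (of_nat (Poly_Mapping.lookup m i) * a)"
  by (cases "a = 0") (simp_all add: pderiv_var_def)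

lemma add_minus_Var_exp:
  assumes "Poly_Mapping.lookup m i \<noteq> 0"
  shows "m + m' - Var_exp i = (m - Var_exp i) + m'"
  using assms by (intro poly_mapping_eqI) (auto simp: lookup_add lookup_minus Var_exp_def lookup_single when_def)

text \<open>Additivity in both factors reduces the product rule to two monomials, where the
  exponents of variable \<open>i\<close> add up. In each of the two resulting terms either that
  exponent is positive and the truncated subtraction is a true one, or the coefficient is
  zero.\<close>

lemma pderiv_var_mult: "pderiv_var i (f * g) = pderiv_var i f * g + f * pderiv_var i g"
proof (induction f rule: poly_mapping_additive_induct)
  case (single m a)
  show ?case
  proof (induction g rule: poly_mapping_additive_induct)
    case (single m' b)
    have left: "Poly_Mapping.single (m + m' - Var_exp i) (of_nat (Poly_Mapping.lookup m i) * a * b) =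
        Poly_Mapping.single (m - Var_exp i + m') (of_nat (Poly_Mapping.lookup m i) * a * b)"
    proof (cases "Poly_Mapping.lookup m i = 0")
      case False
      show ?thesis
        unfolding add_minus_Var_exp[OF False] ..
    qed (simp only: of_nat_0 mult_zero_left single_zero)
    have right: "Poly_Mapping.single (m + m' - Var_exp i) (of_nat (Poly_Mapping.lookup m' i) * a * b) =
        Poly_Mapping.single (m + (m' - Var_exp i)) (of_nat (Poly_Mapping.lookup m' i) * a * b)"
    proof (cases "Poly_Mapping.lookup m' i = 0")
      case False
      show ?thesis
        unfolding add.commute[of m m'] add_minus_Var_exp[OF False] add.commute[of m] ..
    qed (simp only: of_nat_0 mult_zero_left single_zero)
    have "pderiv_var i (Poly_Mapping.single m a * Poly_Mapping.single m' b) =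
        Poly_Mapping.single (m + m' - Var_exp i) (of_nat (Poly_Mapping.lookup m i) * a * b)
        + Poly_Mapping.single (m + m' - Var_exp i) (of_nat (Poly_Mapping.lookup m' i) * a * b)"
      by (simp only: mult_single pderiv_var_single lookup_add of_nat_add distrib_right single_add mult.assoc)
    also have "\<dots> = pderiv_var i (Poly_Mapping.single m a) * Poly_Mapping.single m' b
        + Poly_Mapping.single m a * pderiv_var i (Poly_Mapping.single m' b)"
      unfolding left right by (simp only: mult_single pderiv_var_single mult.assoc mult.left_commute)
    finally show ?case .
  qed (simp add: pderiv_var_add distrib_left)
qed (simp add: pderiv_var_add distrib_right)

lemma dir_deriv_mult: "dir_deriv l (f * g) = dir_deriv l f * g + f * dir_deriv l g"
  unfolding dir_deriv_def pderiv_var_mult sum_distrib_left sum_distrib_right sum.distrib[symmetric]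
  by (rule sum.cong) (simp_all only: distrib_left mult.assoc mult.left_commute)

subsection \<open>Linear forms\<close>

abbreviation Const :: "'k::field \<Rightarrow> ('k, 'n::finite) mpoly" where
  "Const \<equiv> Poly_Mapping.single 0"

definition lin :: "'k::field ^ 'n::finite \<Rightarrow> ('k, 'n) mpoly" where
  "lin a = (\<Sum>i\<in>UNIV. Poly_Mapping.single (Var_exp i) (a $ i))"

definition dot :: "'k::field ^ 'n::finite \<Rightarrow> 'k ^ 'n \<Rightarrow> 'k" where
  "dot a v = (\<Sum>i\<in>UNIV. a $ i * v $ i)"

lemma dot_simps [simp]:
  "dot (a + b) v = dot a v + dot b v" "dot (a - b) v = dot a v - dot b v" "dot (c *s a) v = c * dot a v"
  "dot a (v + w) = dot a v + dot a w" "dot a (v - w) = dot a v - dot a w" "dot a (c *s v) = c * dot a v"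
  "dot 0 v = 0" "dot a 0 = 0"
  by (simp_all add: dot_def sum.distrib sum_subtractf sum_distrib_left distrib_left distrib_right
      left_diff_distrib right_diff_distrib mult.assoc mult.left_commute)

lemma dot_axis: "dot a (axis i 1) = a $ i"
  by (simp add: dot_def axis_def if_distrib cong: if_cong)

lemma dot_eqI: "(\<And>v. dot a v = dot b v) \<Longrightarrow> a = b"
  by (metis dot_axis vec_eq_iff)

lemma ex_dot_eq_1:
  assumes "a \<noteq> 0"
  obtains e where "dot a e = 1"
proof -
  obtain i where "a $ i \<noteq> 0"
    using assms by (auto simp: vec_eq_iff)
  then have "dot a (inverse (a $ i) *s axis i 1) = 1"
    by (simp add: dot_axis)
  then show thesis ..
qed

text \<open>If \<open>dot a e = 1\<close>, then \<open>v - dot a v *s e\<close> lies in the kernel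
  of \<open>a\<close>, hence in that of \<open>b\<close>. So \<open>b\<close> is determined by its
  value at \<open>e\<close>.\<close>

lemma kernel_subset_imp_multiple:
  assumes "\<And>v. dot a v = 0 \<Longrightarrow> dot b v = 0"
  obtains c where "b = c *s a"
proof (cases "a = 0")
  case True
  then have "b = 0 *s a"
    using assms by (intro dot_eqI) simp
  then show thesis ..
next
  case False
  then obtain e where e: "dot a e = 1"
    by (rule ex_dot_eq_1)
  have "dot b v = dot (dot b e *s a) v" for v
    using assms[of "v - dot a v *s e"] e by (simp add: mult.commute)
  then have "b = dot b e *s a"
    by (rule dot_eqI)
  then show thesis ..
qed

lemma kernel_Int_subset_imp_combination:
  assumes "\<And>v. dot x v = 0 \<Longrightarrow> dot y v = 0 \<Longrightarrow> dot z v = 0"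
  obtains c d where "z = c *s x + d *s y"
proof (cases "x = 0")
  case True
  then obtain d where "z = d *s y"
    using assms kernel_subset_imp_multiple[of y z] by auto
  then have "z = 0 *s x + d *s y"
    by simp
  then show thesis ..
next
  case False
  then obtain e where e: "dot x e = 1"
    by (rule ex_dot_eq_1)
  \<comment> \<open>Corrected by multiples of \<open>x\<close>, both \<open>y\<close> and
    \<open>z\<close> vanish at \<open>e\<close>, so any \<open>v\<close> may be moved along
    \<open>e\<close> into the kernel of \<open>x\<close> without changing their values. This leaves
    the case of a single kernel.\<close>
  have "dot (z - dot z e *s x) v = 0" if "dot (y - dot y e *s x) v = 0" for v
    using assms[of "v - dot x v *s e"] e that by (simp add: mult.commute)
  then obtain d where d: "z - dot z e *s x = d *s (y - dot y e *s x)"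
    by (rule kernel_subset_imp_multiple)
  have "z = (dot z e - d * dot y e) *s x + d *s y"
    using d by (simp add: vec_eq_iff algebra_simps)
  then show thesis ..
qed

lemma Var_exp_eq_iff [simp]: "Var_exp i = Var_exp j \<longleftrightarrow> i = j"
  by (metis Var_exp_def lookup_single_eq lookup_single_not_eq zero_neq_one)

lemma lookup_lin_Var_exp: "Poly_Mapping.lookup (lin a) (Var_exp i) = a $ i"
  by (simp add: lin_def lookup_sum lookup_single when_def)

lemma lin_coeffs_lin [simp]: "lin_coeffs (lin a) = a"
  by (simp add: lin_coeffs_def lookup_lin_Var_exp vec_eq_iff)

lemma lin_zero [simp]: "lin 0 = 0"
  by (simp add: lin_def)

lemma lin_eq_0_iff [simp]: "lin a = 0 \<longleftrightarrow> a = 0"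
  by (metis lin_coeffs_lin lin_zero)

lemma lin_add: "lin (a + b) = lin a + lin b"
  by (simp add: lin_def single_add sum.distrib)

lemma lin_diff: "lin (a - b) = lin a - lin b"
  using lin_add[of "a - b" b] by simp

lemma lin_scale: "lin (c *s a) = Const c * lin a"
  by (simp add: lin_def sum_distrib_left mult_single)

lemma degree_1_iff:
  fixes m :: "'n::finite \<Rightarrow>\<^sub>0 nat"
  shows "(\<Sum>i\<in>UNIV. Poly_Mapping.lookup m i) = 1 \<longleftrightarrow> m \<in> range Var_exp"
proof
  assume "(\<Sum>i\<in>UNIV. Poly_Mapping.lookup m i) = 1"
  then obtain i where "Poly_Mapping.lookup m i = 1" "\<And>j. j \<noteq> i \<Longrightarrow> Poly_Mapping.lookup m j = 0"
    using sum_eq_1_iff[of UNIV "Poly_Mapping.lookup m"] by (metis UNIV_I finite)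
  then have "m = Var_exp i"
    by (intro poly_mapping_eqI) (auto simp: Var_exp_def lookup_single when_def)
  then show "m \<in> range Var_exp" by simp
qed (auto simp: Var_exp_def lookup_single when_def)

lemma forms_1_eq: "(forms 1 :: ('k::field, 'n::finite) mpoly set) = range lin"
proof (intro equalityI subsetI)
  fix f :: "('k, 'n) mpoly"
  assume f: "f \<in> forms 1"
  have "f = lin (lin_coeffs f)"
  proof (rule poly_mapping_eqI)
    fix m
    show "Poly_Mapping.lookup f m = Poly_Mapping.lookup (lin (lin_coeffs f)) m"
    proof (cases "m \<in> range Var_exp")
      case True
      then show ?thesis
        by (auto simp: lookup_lin_Var_exp lin_coeffs_def)
    next
      case False
      then have "Poly_Mapping.lookup f m = 0"
        using f by (auto simp: forms_def in_keys_iff degree_1_iff simp del: One_nat_def)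
      moreover have "Var_exp i \<noteq> m" for i
        using False by auto
      ultimately show ?thesis
        by (simp add: lin_def lookup_sum lookup_single when_def)
    qed
  qed
  then show "f \<in> range lin"
    by blast
next
  fix f :: "('k, 'n) mpoly"
  assume "f \<in> range lin"
  then have "Poly_Mapping.keys f \<subseteq> range Var_exp"
    using keys_sum by (fastforce simp: lin_def split: if_splits)
  then show "f \<in> forms 1"
    by (auto simp: forms_def degree_1_iff simp del: One_nat_def)
qed

lemma forms_mult: "f \<in> forms j \<Longrightarrow> g \<in> forms k \<Longrightarrow> f * g \<in> forms (j + k)"
  using keys_mult[of f g] by (fastforce simp: forms_def lookup_add sum.distrib)

lemma forms_prod_1:
  "finite I \<Longrightarrow> (\<And>i. i \<in> I \<Longrightarrow> f i \<in> forms 1) \<Longrightarrow> (\<Prod>i\<in>I. f i) \<in> forms (card I)"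
proof (induction I rule: finite_induct)
  case empty
  show ?case by (simp add: forms_def)
next
  case (insert i I)
  then show ?case
    using forms_mult[of "f i" 1 "\<Prod>i\<in>I. f i" "card I"] by simp
qed

lemma eval_at_lin [simp]: "eval_at (lin a) v = dot a v"
proof -
  have "id_hom.msubst (($) v) (\<Sum>i\<in>I. Poly_Mapping.single (Var_exp i) (a $ i)) = (\<Sum>i\<in>I. a $ i * v $ i)" for I
    by (induction I rule: infinite_finite_induct)
      (simp_all add: id_hom.msubst_add id_hom.msubst_Var id_hom.msubst_def[of _ 0])
  then show ?thesis
    by (simp add: eval_at_eq_msubst lin_def dot_def)
qed

lemma pderiv_var_lin: "pderiv_var i (lin a) = Const (a $ i)"
proof -
  have "pderiv_var i (\<Sum>j\<in>J. Poly_Mapping.single (Var_exp j) (a $ j)) = (\<Sum>j\<in>J. if j = i then Const (a $ i) else 0)" for J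
    by (induction J rule: infinite_finite_induct)
      (auto simp: pderiv_var_add pderiv_var_single Var_exp_def lookup_single when_def pderiv_var_def[of _ 0])
  then show ?thesis
    by (simp add: lin_def)
qed

lemma dir_deriv_lin: "dir_deriv l (lin a) = Const (dot a (lin_coeffs l))"
  by (simp add: dir_deriv_def pderiv_var_lin mult_single sum_single dot_def mult.commute)

section \<open>Congruences and restriction to a hyperplane\<close>

lemma dvd_diff_mult:
  fixes d :: "'r::comm_ring_1"
  assumes "d dvd s - t" and "d dvd s' - t'"
  shows "d dvd s * s' - t * t'"
proof -
  have "s * s' - t * t' = (s - t) * s' + t * (s' - t')"
    by (simp add: algebra_simps)
  then show ?thesis using assms by simp
qed

lemma dvd_diff_power:
  fixes d :: "'r::comm_ring_1"
  shows "d dvd s - t \<Longrightarrow> d dvd s ^ n - t ^ n"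
  by (induction n) (auto intro: dvd_diff_mult)

lemma dvd_diff_prod:
  fixes d :: "'r::comm_ring_1"
  shows "(\<And>i. i \<in> I \<Longrightarrow> d dvd s i - t i) \<Longrightarrow> d dvd (\<Prod>i\<in>I. s i) - (\<Prod>i\<in>I. t i)"
  by (induction I rule: infinite_finite_induct) (auto intro: dvd_diff_mult)

lemma (in coefficient_hom) dvd_diff_msubst:
  assumes "\<And>i. d dvd \<phi> i - \<psi> i"
  shows "d dvd msubst \<phi> f - msubst \<psi> f"
  unfolding msubst_def sum_subtractf[symmetric]
  by (intro dvd_sum dvd_diff_mult dvd_diff_prod dvd_diff_power assms) simp

lemma msubst_variables: "const_hom.msubst (\<lambda>i. Poly_Mapping.single (Var_exp i) 1) f = f"
proof (induction f rule: poly_mapping_additive_induct)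
  case (single m a)
  have "(\<Sum>i\<in>UNIV. Poly_Mapping.single i (Poly_Mapping.lookup m i)) = m"
    by (rule poly_mapping_eqI) (simp add: lookup_sum lookup_single when_def)
  then show ?case
    unfolding Var_exp_def const_hom.msubst_single single_one_power
    by (simp add: prod_single_one mult_single)
qed (simp add: const_hom.msubst_add)

text \<open>The projection along \<open>e\<close> onto the hyperplane \<open>lin a = 0\<close>, provided that \<open>dot a e = 1\<close>.\<close>

definition proj_along :: "'k::field ^ 'n::finite \<Rightarrow> 'k ^ 'n \<Rightarrow> ('k, 'n) mpoly \<Rightarrow> ('k, 'n) mpoly" where
  "proj_along e a =
     const_hom.msubst (\<lambda>i. Poly_Mapping.single (Var_exp i) 1 - Const (e $ i) * lin a)"

lemma proj_along_mult: "proj_along e a (f * g) = proj_along e a f * proj_along e a g"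
  by (simp add: proj_along_def const_hom.msubst_mult)

lemma proj_along_add: "proj_along e a (f + g) = proj_along e a f + proj_along e a g"
  by (simp add: proj_along_def const_hom.msubst_add)

lemma proj_along_diff: "proj_along e a (f - g) = proj_along e a f - proj_along e a g"
  using proj_along_add[of e a "f - g" g] by simp

lemma proj_along_Const: "proj_along e a (Const c) = Const c"
  by (simp add: proj_along_def const_hom.msubst_const)

lemma proj_along_prod: "proj_along e a (\<Prod>i\<in>I. f i) = (\<Prod>i\<in>I. proj_along e a (f i))"
  by (simp add: proj_along_def const_hom.msubst_prod)

lemma proj_along_lin:
  fixes a b e :: "'k::field ^ 'n::finite"
  shows "proj_along e a (lin b) = lin (b - dot b e *s a)"
proof -
  have *: "const_hom.msubst \<phi> (\<Sum>i\<in>I. Poly_Mapping.single (Var_exp i) (b $ i)) = (\<Sum>i\<in>I. Const (b $ i) * \<phi> i)"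
    for I :: "'n set" and \<phi> :: "'n \<Rightarrow> ('k, 'n) mpoly"
    by (induction I rule: infinite_finite_induct)
      (simp_all add: const_hom.msubst_add const_hom.msubst_Var const_hom.msubst_def[of _ 0])
  have "proj_along e a (lin b) = (\<Sum>i\<in>UNIV. Poly_Mapping.single (Var_exp i) (b $ i) - Const (b $ i * e $ i) * lin a)"
    unfolding proj_along_def lin_def[of b] *
    by (rule sum.cong) (simp_all add: right_diff_distrib mult_single flip: mult.assoc)
  also have "\<dots> = lin b - Const (dot b e) * lin a"
    by (simp add: sum_subtractf lin_def[of b] dot_def flip: sum_distrib_right sum_single)
  finally show ?thesis
    by (simp add: lin_diff lin_scale)
qed

text \<open>The projection changes each variable by a multiple of \<open>lin a\<close>, and a
  substitution respects congruences between the substituted values.\<close>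

lemma lin_dvd_diff_proj_along: "lin a dvd f - proj_along e a f"
  using const_hom.dvd_diff_msubst[of "lin a" "\<lambda>i. Poly_Mapping.single (Var_exp i) 1"
      "\<lambda>i. Poly_Mapping.single (Var_exp i) 1 - Const (e $ i) * lin a" f]
  by (simp add: msubst_variables proj_along_def)

lemma lin_dvd_iff:
  assumes "dot a e = 1"
  shows "lin a dvd f \<longleftrightarrow> proj_along e a f = 0"
proof
  assume "lin a dvd f"
  then show "proj_along e a f = 0"
    using assms by (auto elim!: dvdE simp: proj_along_mult proj_along_lin)
next
  assume "proj_along e a f = 0"
  then show "lin a dvd f"
    using lin_dvd_diff_proj_along[of a f e] by simp
qed

text \<open>The multiples of \<open>lin a\<close> are the kernel of \<open>proj_along e a\<close>, a
  ring map that fixes 1 and takes values in a domain.\<close>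

lemma prime_elem_lin:
  assumes "a \<noteq> 0"
  shows "prime_elem (lin a)"
proof -
  obtain e where e: "dot a e = 1"
    using assms by (rule ex_dot_eq_1)
  show ?thesis
  proof (rule prime_elemI)
    show "\<not> lin a dvd 1"
      using proj_along_Const[of e a 1] by (simp add: lin_dvd_iff[OF e])
  qed (use assms e in \<open>auto simp: lin_dvd_iff[OF e] proj_along_mult dest: mpoly_no_zero_divisors\<close>)
qed

lemma lin_dvd_lin_iff:
  assumes "a \<noteq> 0"
  shows "lin a dvd lin b \<longleftrightarrow> (\<exists>c. b = c *s a)"
proof
  assume "lin a dvd lin b"
  moreover obtain e where e: "dot a e = 1"
    using assms by (rule ex_dot_eq_1)
  ultimately have "b = dot b e *s a"
    by (simp add: lin_dvd_iff[OF e] proj_along_lin)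
  then show "\<exists>c. b = c *s a" ..
qed (auto simp: lin_scale)

lemma prime_elem_dvd_prod:
  fixes q :: "'r::comm_semiring_1"
  assumes "prime_elem q" and "q dvd (\<Prod>i\<in>I. f i)"
  shows "\<exists>i\<in>I. q dvd f i"
  using assms(2)
  by (induction I rule: infinite_finite_induct)
    (use assms(1) in \<open>auto simp: prime_elem_dvd_mult_iff dest: prime_elem_not_unit\<close>)

text \<open>The primes are split off one at a time: a new one does not divide the product of the
  earlier ones, so it divides the remaining cofactor. Unique factorization is thereby
  avoided.\<close>

lemma prod_prime_elems_dvd:
  fixes f :: "'i \<Rightarrow> 'r::comm_semiring_1"
  assumes "finite I" and "\<And>i. i \<in> I \<Longrightarrow> prime_elem (f i)" and "\<And>i. i \<in> I \<Longrightarrow> f i dvd u"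
    and "\<And>i j. i \<in> I \<Longrightarrow> j \<in> I \<Longrightarrow> i \<noteq> j \<Longrightarrow> \<not> f i dvd f j"
  shows "(\<Prod>i\<in>I. f i) dvd u"
  using assms
proof (induction I rule: finite_induct)
  case (insert i I)
  then have "(\<Prod>i\<in>I. f i) dvd u"
    by auto
  then obtain q where q: "u = (\<Prod>i\<in>I. f i) * q" ..
  have "prime_elem (f i)" "f i dvd (\<Prod>i\<in>I. f i) * q"
    using insert.prems q by auto
  moreover have "\<not> f i dvd (\<Prod>i\<in>I. f i)"
    using prime_elem_dvd_prod[of "f i" f I] insert by auto
  ultimately have "f i dvd q"
    by (simp add: prime_elem_dvd_mult_iff)
  then show ?case
    using insert.hyps q by (simp add: mult.commute mult_dvd_mono)
qed simp

subsection \<open>Residuals through congruences\<close>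

lemma Const_mult_inverse: "c \<noteq> 0 \<Longrightarrow> Const (inverse c) * (Const c * f) = f"
  by (simp add: mult_single flip: mult.assoc)

lemma dvd_Const_mult_iff:
  assumes "c \<noteq> 0"
  shows "f dvd Const c * g \<longleftrightarrow> f dvd g"
  using assms by (metis Const_mult_inverse dvd_mult)

lemma lin_scale_dvd_iff:
  assumes "c \<noteq> 0"
  shows "lin (c *s a) dvd f \<longleftrightarrow> lin a dvd f"
proof -
  have "lin a = lin (inverse c *s (c *s a))"
    using assms by simp
  then have "lin (c *s a) dvd lin a"
    by (metis lin_scale dvd_triv_right)
  moreover have "lin a dvd lin (c *s a)"
    by (simp add: lin_scale)
  ultimately show ?thesis
    by (blast intro: dvd_trans)
qed

lemma in_ideal_gen_singleton: "g \<in> ideal_gen {p} \<longleftrightarrow> p dvd g"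
  by (auto simp: ideal.span_singleton dvd_def mult.commute)

lemma in_ideal_gen_pair: "g \<in> ideal_gen {p, q} \<longleftrightarrow> (\<exists>u v. g = u * p + v * q)"
proof -
  have "g \<in> ideal_gen {p, q} \<longleftrightarrow> (\<exists>u v. g - u * p = v * q)"
    unfolding ideal.span_insert[of p] by (auto simp: ideal.span_singleton)
  then show ?thesis
    by (simp add: diff_eq_eq add.commute)
qed

lemma in_colon_ideal_gen: "g \<in> colon (ideal_gen X) (ideal_gen Y) \<longleftrightarrow> (\<forall>h\<in>Y. g * h \<in> ideal_gen X)"
proof
  assume *: "\<forall>h\<in>Y. g * h \<in> ideal_gen X"
  have "g * h \<in> ideal_gen X" if "h \<in> ideal_gen Y" for h
    using that
  proof (induction rule: ideal.span_induct_alt)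
    case base
    show ?case by (simp add: ideal.span_zero)
  next
    case (step c h k)
    have "g * (c * h + k) = c * (g * h) + g * k"
      by (simp add: algebra_simps)
    with step * show ?case
      by (simp add: ideal.span_add ideal.span_scale)
  qed
  then show "g \<in> colon (ideal_gen X) (ideal_gen Y)"
    by (simp add: colon_def)
qed (auto simp: colon_def ideal.span_base)

text \<open>Here \<open>v\<close> stands for the multiplier of the directional derivative when
  \<open>g\<close> times the \<open>i\<close>-th partial derivative is written in the ideal. The
  direction enters only through the scaling of \<open>N h\<close>.\<close>

definition log_residual ::
    "('h \<Rightarrow> 'k::field ^ 'n::finite) \<Rightarrow> 'h set \<Rightarrow> ('k, 'n) mpoly set" where
  "log_residual N A = {g. \<forall>i. \<exists>v. \<forall>h\<in>A. lin (N h) dvd v - Const (N h $ i) * g}"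

lemma log_residual_mono: "B \<subseteq> A \<Longrightarrow> log_residual N A \<subseteq> log_residual N B"
  unfolding log_residual_def by blast

lemma log_residual_add:
  assumes "f \<in> log_residual N A" and "g \<in> log_residual N A"
  shows "f + g \<in> log_residual N A"
proof -
  have "\<exists>w. \<forall>h\<in>A. lin (N h) dvd w - Const (N h $ i) * (f + g)" for i
  proof -
    obtain u v where "\<forall>h\<in>A. lin (N h) dvd u - Const (N h $ i) * f" "\<forall>h\<in>A. lin (N h) dvd v - Const (N h $ i) * g"
      using assms unfolding log_residual_def by blast
    moreover have "u + v - Const (N h $ i) * (f + g) = (u - Const (N h $ i) * f) + (v - Const (N h $ i) * g)" for h
      by (simp add: algebra_simps)
    ultimately have "\<forall>h\<in>A. lin (N h) dvd (u + v) - Const (N h $ i) * (f + g)"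
      by (metis dvd_add)
    then show ?thesis ..
  qed
  then show ?thesis
    by (simp add: log_residual_def)
qed

lemma log_residual_mult:
  assumes "f \<in> log_residual N A"
  shows "q * f \<in> log_residual N A"
proof -
  have "\<exists>w. \<forall>h\<in>A. lin (N h) dvd w - Const (N h $ i) * (q * f)" for i
  proof -
    obtain u where "\<forall>h\<in>A. lin (N h) dvd u - Const (N h $ i) * f"
      using assms by (auto simp: log_residual_def)
    moreover have "q * u - Const (N h $ i) * (q * f) = q * (u - Const (N h $ i) * f)" for h
      by (simp add: algebra_simps)
    ultimately have "\<forall>h\<in>A. lin (N h) dvd q * u - Const (N h $ i) * (q * f)"
      by auto
    then show ?thesis ..
  qed
  then show ?thesis
    by (simp add: log_residual_def)
qed

text \<open>
  Modulo a factor \<open>m\<close> of \<open>f = m g\<close>, a derivation \<open>D\<close> takes \<open>f\<close> to \<open>D m \<cdot> g\<close>, and \<open>g\<close> can be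
  cancelled. Membership in the residual thus becomes one congruence for each hyperplane.
\<close>

lemma residual_iff_log_residual:
  fixes b :: "'h \<Rightarrow> 'k::field ^ 'n::finite" and l :: "('k, 'n) mpoly"
  defines "f A \<equiv> \<Prod>h\<in>A. lin (b h)"
  defines "c h \<equiv> dot (b h) (lin_coeffs l)"
  assumes fin: "finite A" and c0: "\<And>h. h \<in> A \<Longrightarrow> c h \<noteq> 0"
    and indep: "\<And>h h'. h \<in> A \<Longrightarrow> h' \<in> A \<Longrightarrow> h \<noteq> h' \<Longrightarrow> \<not> lin (b h) dvd lin (b h')"
  shows "colon (ideal_gen {f A, dir_deriv l (f A)}) (jacobian_ideal (f A)) =
    log_residual (\<lambda>h. inverse (c h) *s b h) A"
proof -
  let ?N = "\<lambda>h. inverse (c h) *s b h"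
  have prime: "prime_elem (lin (b h))" if "h \<in> A" for h
    using c0[OF that] by (intro prime_elem_lin) (auto simp: c_def)
  have local_iff: "lin (b h) dvd g * pderiv_var i (f A) - v * dir_deriv l (f A) \<longleftrightarrow>
      lin (?N h) dvd v - Const (?N h $ i) * g" if h: "h \<in> A" for g v h i
  proof -
    let ?g = "f (A - {h})"
    have fA: "f A = lin (b h) * ?g"
      unfolding f_def using fin h by (rule prod.remove)
    have not_dvd: "\<not> lin (b h) dvd ?g"
      unfolding f_def using prime_elem_dvd_prod[OF prime[OF h]] indep h by blast
    have Const_c: "Const (b h $ i) = Const (c h) * Const (?N h $ i)"
      using c0[OF h] by (simp add: mult_single flip: mult.assoc)
    have "g * pderiv_var i (f A) - v * dir_deriv l (f A) =
        (g * pderiv_var i ?g - v * dir_deriv l ?g) * lin (b h)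
        - Const (c h) * (v - Const (?N h $ i) * g) * ?g"
      unfolding fA pderiv_var_mult dir_deriv_mult pderiv_var_lin dir_deriv_lin Const_c
      by (simp add: c_def algebra_simps)
    also have "lin (b h) dvd \<dots> \<longleftrightarrow> lin (b h) dvd Const (c h) * (v - Const (?N h $ i) * g) * ?g"
      by (metis dvd_add_right_iff dvd_minus_iff dvd_triv_right uminus_add_conv_diff add.commute)
    also have "\<dots> \<longleftrightarrow> lin (b h) dvd v - Const (?N h $ i) * g"
      using prime[OF h] not_dvd c0[OF h]
      by (simp only: prime_elem_dvd_mult_iff[OF prime[OF h]] dvd_Const_mult_iff[OF c0[OF h]]) simp
    also have "\<dots> \<longleftrightarrow> lin (?N h) dvd v - Const (?N h $ i) * g"
      using c0[OF h] by (intro lin_scale_dvd_iff[symmetric]) simp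
    finally show ?thesis .
  qed
  have "g * pderiv_var i (f A) \<in> ideal_gen {f A, dir_deriv l (f A)} \<longleftrightarrow>
      (\<exists>v. \<forall>h\<in>A. lin (?N h) dvd v - Const (?N h $ i) * g)" for g i
  proof -
    have "g * pderiv_var i (f A) \<in> ideal_gen {f A, dir_deriv l (f A)} \<longleftrightarrow>
        (\<exists>v. f A dvd g * pderiv_var i (f A) - v * dir_deriv l (f A))"
      unfolding in_ideal_gen_pair dvd_def
      by (metis add_diff_cancel_right' diff_add_cancel mult.commute)
    \<comment> \<open>The factors of \<open>f A\<close> are pairwise non-associated primes, so
      divisibility by their product can be tested on each factor.\<close>
    also have "\<dots> \<longleftrightarrow> (\<exists>v. \<forall>h\<in>A. lin (b h) dvd g * pderiv_var i (f A) - v * dir_deriv l (f A))"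
    proof (intro ex_cong1 iffI ballI)
      fix v h
      assume "f A dvd g * pderiv_var i (f A) - v * dir_deriv l (f A)" "h \<in> A"
      moreover have "lin (b h) dvd f A"
        unfolding f_def using fin \<open>h \<in> A\<close> by (rule dvd_prodI)
      ultimately show "lin (b h) dvd g * pderiv_var i (f A) - v * dir_deriv l (f A)"
        by (blast intro: dvd_trans)
    next
      fix v
      assume "\<forall>h\<in>A. lin (b h) dvd g * pderiv_var i (f A) - v * dir_deriv l (f A)"
      then have "(\<Prod>h\<in>A. lin (b h)) dvd g * pderiv_var i (f A) - v * dir_deriv l (f A)"
        using fin prime indep by (intro prod_prime_elems_dvd) auto
      then show "f A dvd g * pderiv_var i (f A) - v * dir_deriv l (f A)"
        by (simp only: f_def)
    qed
    finally show ?thesis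
      by (simp only: local_iff cong: ball_cong)
  qed
  then show ?thesis
    by (auto simp only: jacobian_ideal_def in_colon_ideal_gen log_residual_def ball_simps mem_Collect_eq)
qed

text \<open>Adding one hyperplane: \<open>h1\<close> is the new one. Vectors \<open>z h\<close> are
  proportional when the hyperplanes have the same trace on it, so \<open>A - T\<close> is the class
  of \<open>h0\<close>, and the members of \<open>T\<close> have traces shared with no other
  hyperplane.\<close>

locale hyperplane_addition =
  fixes N :: "'h \<Rightarrow> 'k::field ^ 'n::finite" and a :: "'k ^ 'n" and A T :: "'h set" and h0 h1 :: 'h
  assumes finite_A: "finite A" and h1: "h1 \<notin> A" and h0: "h0 \<in> A" and T: "T \<subseteq> A" "h0 \<notin> T"
    and dot_N: "\<And>h. h \<in> insert h1 A \<Longrightarrow> dot (N h) a = 1"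
    and inj_N: "inj_on N (insert h1 A)"
    and pencil: "\<And>h. h \<in> A - T \<Longrightarrow> \<exists>c. N h - N h1 = c *s (N h0 - N h1)"
    and indep: "\<And>h h' c. h \<in> insert h0 T \<Longrightarrow> h' \<in> insert h0 T \<Longrightarrow> h \<noteq> h' \<Longrightarrow>
      N h' - N h1 \<noteq> c *s (N h - N h1)"
begin

abbreviation z :: "'h \<Rightarrow> 'k ^ 'n" where
  "z h \<equiv> N h - N h1"

definition p :: "('k, 'n) mpoly" where
  "p = lin (z h0) * (\<Prod>h\<in>T. lin (N h))"

lemma finite_T: "finite T"
  using T(1) finite_A by (rule finite_subset)

lemma dot_N1: "dot (N h1) a = 1"
  by (simp add: dot_N)

lemma z_nonzero: "h \<in> A \<Longrightarrow> z h \<noteq> 0"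
  using inj_N h1 by (auto simp: inj_on_def)

lemma N_nonzero: "h \<in> insert h1 A \<Longrightarrow> N h \<noteq> 0"
  using dot_N[of h] by auto

lemma prime_N: "h \<in> insert h1 A \<Longrightarrow> prime_elem (lin (N h))"
  by (intro prime_elem_lin N_nonzero)

lemma N_not_dvd_N:
  assumes "h \<in> insert h1 A" "h' \<in> insert h1 A" "h \<noteq> h'"
  shows "\<not> lin (N h) dvd lin (N h')"
proof
  assume "lin (N h) dvd lin (N h')"
  then obtain c where c: "N h' = c *s N h"
    using assms N_nonzero by (auto simp: lin_dvd_lin_iff)
  then have "c = 1"
    using dot_N[of h] dot_N[of h'] assms by simp
  then show False
    using c assms inj_N by (auto simp: inj_on_def)
qed

lemma N1_not_dvd_p: "\<not> lin (N h1) dvd p"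
proof
  assume "lin (N h1) dvd p"
  then consider "lin (N h1) dvd lin (z h0)" | "lin (N h1) dvd (\<Prod>h\<in>T. lin (N h))"
    by (auto simp: p_def prime_elem_dvd_mult_iff prime_N)
  then show False
  proof cases
    case 1
    then obtain c where c: "z h0 = c *s N h1"
      using N_nonzero by (auto simp: lin_dvd_lin_iff)
    \<comment> \<open>The normalisation separates the two forms: \<open>z h0\<close> vanishes at
      \<open>a\<close>, while \<open>N h1\<close> takes the value 1 there.\<close>
    have "dot (z h0) a = dot (c *s N h1) a"
      by (simp only: c)
    then have "c = 0"
      using h0 by (simp add: dot_N)
    then show False
      using c z_nonzero[OF h0] by simp
  next
    case 2
    then show False
      using prime_elem_dvd_prod[OF prime_N, of h1] N_not_dvd_N[of h1] T h1 by blast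
  qed
qed

lemma p_in_log_residual_insert: "p \<in> log_residual N (insert h1 A)"
proof -
  let ?P = "\<Prod>h\<in>T. lin (N h)"
  \<comment> \<open>For \<open>h\<close> outside \<open>T\<close>,
    \<open>N h = N h1 + c *s z h0\<close>, so \<open>lin (N h1)\<close> is congruent to
    \<open>- Const c * lin (z h0)\<close> modulo \<open>lin (N h)\<close>, which turns the witness
    into \<open>Const (N h $ i) * p\<close>. The witness does not involve \<open>c\<close>, so it
    serves the whole class and also \<open>h1\<close>, where \<open>c = 0\<close>. For
    \<open>h\<close> in \<open>T\<close> the factor \<open>?P\<close> vanishes modulo
    \<open>lin (N h)\<close>.\<close>
  have "lin (N h) dvd (Const (N h1 $ i) * lin (z h0) - Const (z h0 $ i) * lin (N h1)) * ?P - Const (N h $ i) * p"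
    if h: "h \<in> insert h1 A" for h i
  proof (cases "h \<in> T")
    case True
    then have "lin (N h) dvd ?P"
      using finite_T by (intro dvd_prodI)
    then show ?thesis
      by (simp add: p_def)
  next
    case False
    obtain c where c: "z h = c *s z h0"
    proof (cases "h = h1")
      case True
      then have "z h = 0 *s z h0" by simp
      then show thesis ..
    qed (use False h pencil[of h] that in auto)
    then have N_h: "N h = N h1 + c *s z h0"
      by (metis add.commute diff_add_cancel)
    then have Const_N_h: "Const (N h $ i) = Const (N h1 $ i) + Const c * Const (z h0 $ i)"
      by (simp add: mult_single flip: single_add)
    have "(Const (N h1 $ i) * lin (z h0) - Const (z h0 $ i) * lin (N h1)) * ?P - Const (N h $ i) * p =
        - (Const (z h0 $ i) * ?P) * (lin (N h1) + Const c * lin (z h0))"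
      unfolding Const_N_h p_def by (simp add: algebra_simps)
    also have "lin (N h1) + Const c * lin (z h0) = lin (N h)"
      by (simp add: N_h lin_add lin_scale)
    finally show ?thesis
      by simp
  qed
  then show ?thesis
    unfolding log_residual_def by blast
qed

lemma log_residual_insert_superset:
  "lin (N h1) *o log_residual N A + ideal_gen {p} \<subseteq> log_residual N (insert h1 A)"
proof
  fix g
  assume "g \<in> lin (N h1) *o log_residual N A + ideal_gen {p}"
  then obtain r q where r: "r \<in> log_residual N A" and g: "g = lin (N h1) * r + q * p"
    by (auto simp: set_plus_def elt_set_times_def ideal.span_singleton)
  have "\<exists>v. \<forall>h\<in>insert h1 A. lin (N h) dvd v - Const (N h $ i) * (lin (N h1) * r)" for i
  proof -
    obtain v where v: "\<forall>h\<in>A. lin (N h) dvd v - Const (N h $ i) * r"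
      using r by (auto simp: log_residual_def)
    \<comment> \<open>Multiplying a solution for \<open>r\<close> by \<open>lin (N h1)\<close> keeps
      the old congruences and makes the one at \<open>h1\<close> trivial.\<close>
    have "lin (N h1) * v - Const (N h $ i) * (lin (N h1) * r) = lin (N h1) * (v - Const (N h $ i) * r)" for h
      by (simp add: algebra_simps)
    then have "\<forall>h\<in>insert h1 A. lin (N h) dvd lin (N h1) * v - Const (N h $ i) * (lin (N h1) * r)"
      using v by auto
    then show ?thesis ..
  qed
  then have "lin (N h1) * r \<in> log_residual N (insert h1 A)"
    by (simp only: log_residual_def mem_Collect_eq) simp
  then show "g \<in> log_residual N (insert h1 A)"
    unfolding g by (rule log_residual_add[OF _ log_residual_mult[OF p_in_log_residual_insert]])
qed

lemma proj_along_N: "h \<in> insert h1 A \<Longrightarrow> proj_along a (N h1) (lin (N h)) = lin (z h)"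
  by (simp add: proj_along_lin dot_N)

text \<open>Each \<open>lin (N h)\<close> reduces to \<open>lin (z h)\<close>, and
  \<open>lin (z h0)\<close> is fixed because \<open>z h0\<close> vanishes at \<open>a\<close>.
  Restricted to the new hyperplane, \<open>p\<close> is thus a product of one linear form for each
  distinct trace.\<close>

lemma proj_along_p: "proj_along a (N h1) p = (\<Prod>h\<in>insert h0 T. lin (z h))"
proof -
  have "proj_along a (N h1) (lin (z h0)) = lin (z h0)"
    using h0 by (simp add: proj_along_lin dot_N)
  moreover have "(\<Prod>h\<in>T. proj_along a (N h1) (lin (N h))) = (\<Prod>h\<in>T. lin (z h))"
    using T by (intro prod.cong) (auto simp: proj_along_N)
  ultimately show ?thesis
    using finite_T T by (simp add: p_def proj_along_mult proj_along_prod)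
qed

text \<open>
  The congruences modulo \<open>N h\<close> and modulo \<open>N h1\<close> determine the same \<open>v\<close>, so that their difference
  is a multiple of \<open>g\<close> in the ideal \<open>(N h1, z h)\<close>.
\<close>

lemma z_dvd_proj_along:
  assumes g: "g \<in> log_residual N (insert h1 A)" and h: "h \<in> A"
  shows "lin (z h) dvd proj_along a (N h1) g"
proof -
  let ?s = "proj_along a (N h1)"
  \<comment> \<open>In a coordinate where the two normals differ, the difference of the congruences
    has an invertible scalar in front of \<open>g\<close>.\<close>
  obtain i where "N h $ i \<noteq> N h1 $ i"
    using z_nonzero[OF h] by (auto simp: vec_eq_iff)
  then have i: "N h1 $ i - N h $ i \<noteq> 0"
    by simp
  obtain v where v: "\<forall>h\<in>insert h1 A. lin (N h) dvd v - Const (N h $ i) * g"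
    using g by (auto simp: log_residual_def)
  have "lin (z h) dvd ?s v - Const (N h $ i) * ?s g"
  proof -
    obtain q where "v - Const (N h $ i) * g = lin (N h) * q"
      using v h by (auto elim: dvdE)
    then have "?s (v - Const (N h $ i) * g) = ?s (lin (N h) * q)"
      by (rule arg_cong)
    then show ?thesis
      using h by (simp add: proj_along_mult proj_along_diff proj_along_Const proj_along_N)
  qed
  moreover have "?s v - Const (N h1 $ i) * ?s g = 0"
    using v by (simp add: lin_dvd_iff[OF dot_N1] proj_along_mult proj_along_diff proj_along_Const)
  then have "?s v - Const (N h $ i) * ?s g = Const (N h1 $ i - N h $ i) * ?s g"
    by (simp add: algebra_simps single_diff)
  ultimately show ?thesis
    by (simp add: dvd_Const_mult_iff[OF i])
qed

lemma log_residual_insert_subset: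
  "log_residual N (insert h1 A) \<subseteq> lin (N h1) *o log_residual N A + ideal_gen {p}"
proof
  fix g
  assume g: "g \<in> log_residual N (insert h1 A)"
  let ?x = "lin (N h1)"
  let ?s = "proj_along a (N h1)"
  have "?s p dvd ?s g"
    unfolding proj_along_p
  proof (rule prod_prime_elems_dvd)
    show "finite (insert h0 T)"
      using finite_T by simp
  next
    fix h assume "h \<in> insert h0 T"
    then have "h \<in> A"
      using h0 T by auto
    then show "prime_elem (lin (z h))" "lin (z h) dvd ?s g"
      using z_nonzero g by (blast intro: prime_elem_lin, blast intro: z_dvd_proj_along)
  next
    fix h h' assume *: "h \<in> insert h0 T" "h' \<in> insert h0 T" "h \<noteq> h'"
    then have "z h \<noteq> 0"
      using h0 T by (intro z_nonzero) auto
    then show "\<not> lin (z h) dvd lin (z h')"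
      using indep[OF *] lin_dvd_lin_iff by blast
  qed
  then obtain q where q: "?s g = ?s p * q" ..
  \<comment> \<open>The cofactor \<open>q\<close> comes from the projected polynomials, but
    projecting does not change residue classes modulo \<open>?x\<close>.\<close>
  have "g - q * p = (g - ?s g) - (p - ?s p) * q"
    by (simp add: q algebra_simps)
  moreover have "?x dvd g - ?s g" "?x dvd p - ?s p"
    by (rule lin_dvd_diff_proj_along)+
  ultimately have "?x dvd g - q * p"
    by (simp only: dvd_diff dvd_mult2)
  then obtain r where r: "g - q * p = ?x * r" ..
  have xr: "?x * r \<in> log_residual N (insert h1 A)"
    using log_residual_add[OF g log_residual_mult[OF p_in_log_residual_insert, of "- q"]] r
    by simp
  have "\<exists>w. \<forall>h\<in>A. lin (N h) dvd w - Const (N h $ i) * r" for i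
  proof -
    obtain v where v: "\<forall>h\<in>insert h1 A. lin (N h) dvd v - Const (N h $ i) * (?x * r)"
      using xr by (auto simp: log_residual_def)
    \<comment> \<open>The congruence at \<open>h1\<close> forces \<open>?x\<close> to divide
      \<open>v\<close>. At the other hyperplanes \<open>?x\<close> cancels, since the prime
      \<open>lin (N h)\<close> does not divide it.\<close>
    then have "?x dvd v - Const (N h1 $ i) * (?x * r)"
      by simp
    then have "?x dvd v"
      using dvd_add[of ?x _ "Const (N h1 $ i) * (?x * r)"] by fastforce
    then obtain w where w: "v = ?x * w" ..
    have "lin (N h) dvd w - Const (N h $ i) * r" if h: "h \<in> A" for h
    proof -
      have "v - Const (N h $ i) * (?x * r) = ?x * (w - Const (N h $ i) * r)"
        by (simp add: w algebra_simps)
      then have "lin (N h) dvd ?x * (w - Const (N h $ i) * r)"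
        using v h by (metis insertI2)
      moreover have "\<not> lin (N h) dvd ?x"
        using h h1 by (intro N_not_dvd_N) auto
      ultimately show ?thesis
        using prime_N[of h] h by (auto simp: prime_elem_dvd_mult_iff)
    qed
    then show ?thesis by blast
  qed
  then have "r \<in> log_residual N A"
    by (simp add: log_residual_def)
  moreover have "g = ?x * r + q * p"
    using r by (simp add: algebra_simps)
  ultimately show "g \<in> ?x *o log_residual N A + ideal_gen {p}"
    by (auto simp: set_plus_def elt_set_times_def ideal.span_singleton)
qed

lemma log_residual_insert:
  "log_residual N (insert h1 A) = lin (N h1) *o log_residual N A + ideal_gen {p}"
  using log_residual_insert_subset log_residual_insert_superset by blast

lemma p_in_log_residual: "p \<in> log_residual N A"
  using p_in_log_residual_insert log_residual_mono[of A "insert h1 A"] by blast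

lemma p_in_forms: "p \<in> forms (card (insert h0 T))"
proof -
  have "(\<Prod>h\<in>T. lin (N h)) \<in> forms (card T)"
    using finite_T by (intro forms_prod_1) (auto simp: forms_1_eq simp del: One_nat_def)
  moreover have "lin (z h0) \<in> forms 1"
    by (simp add: forms_1_eq del: One_nat_def)
  ultimately have "p \<in> forms (1 + card T)"
    unfolding p_def by (intro forms_mult)
  then show ?thesis
    using finite_T T by simp
qed

end

subsection \<open>Hyperplanes\<close>

lemma ex_common_nonzero:
  fixes B :: "('k::field_char_0 ^ 'n::finite) set"
  assumes "finite B" and "0 \<notin> B"
  shows "\<exists>v. \<forall>b\<in>B. dot b v \<noteq> 0"
  using assms
proof (induction B rule: finite_induct)
  case (insert b B)
  then obtain v where v: "\<forall>b\<in>B. dot b v \<noteq> 0"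
    by auto
  obtain e where e: "dot b e = 1"
    using insert.prems ex_dot_eq_1[of b] by auto
  \<comment> \<open>Each vector not vanishing at \<open>e\<close> excludes one scalar
    \<open>t\<close>, and the field is infinite. For a vector vanishing at \<open>e\<close> the
    quotient is 0 by convention, which excludes only one more scalar.\<close>
  obtain t where t: "t \<notin> (\<lambda>b. - dot b v / dot b e) ` insert b B"
    using ex_new_if_finite[OF infinite_UNIV_char_0, of "(\<lambda>b. - dot b v / dot b e) ` insert b B"]
      insert.hyps by auto
  have "dot b' (v + t *s e) \<noteq> 0" if "b' \<in> insert b B" for b'
  proof (cases "dot b' e = 0")
    case True
    then show ?thesis
      using that v e by auto
  next
    case False
    then have "t \<noteq> - dot b' v / dot b' e"
      using t that by blast
    with False show ?thesis
      by (auto simp: field_simps add_eq_0_iff2)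
  qed
  then show ?case by blast
qed simp

lemma span_in_proj_zeros_iff:
  assumes "v \<noteq> 0"
  shows "vec.span {v} \<in> proj_zeros (lin b) \<longleftrightarrow> dot b v = 0"
proof
  assume "vec.span {v} \<in> proj_zeros (lin b)"
  then obtain w where w: "vec.span {v} = vec.span {w}" "dot b w = 0"
    by (auto simp: proj_zeros_def)
  have "v \<in> vec.span {w}"
    unfolding w(1)[symmetric] by (simp add: vec.span_base)
  then show "dot b v = 0"
    using w(2) by (auto simp: vec.span_singleton)
qed (use assms in \<open>auto simp: proj_zeros_def\<close>)

lemma proj_zeros_cases:
  assumes "P \<in> proj_zeros f"
  obtains v where "v \<noteq> 0" and "P = vec.span {v}"
  using assms by (auto simp: proj_zeros_def)

lemma proj_zeros_lin_scale: "c \<noteq> 0 \<Longrightarrow> proj_zeros (lin (c *s a)) = proj_zeros (lin a)"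
  by (simp add: proj_zeros_def)

lemma proj_zeros_lin_eqD:
  assumes "proj_zeros (lin a) = proj_zeros (lin b)"
  obtains c where "b = c *s a"
proof (rule kernel_subset_imp_multiple)
  fix v
  assume "dot a v = 0"
  then show "dot b v = 0"
    using assms span_in_proj_zeros_iff[of v] by (cases "v = 0") auto
qed

lemma proj_zeros_Int_eqD:
  assumes "proj_zeros (lin y) \<inter> proj_zeros (lin x) = proj_zeros (lin z) \<inter> proj_zeros (lin x)"
  obtains c d where "z = c *s x + d *s y"
proof (rule kernel_Int_subset_imp_combination)
  fix v
  assume v: "dot x v = 0" "dot y v = 0"
  show "dot z v = 0"
  proof (cases "v = 0")
    case False
    then have "vec.span {v} \<in> proj_zeros (lin y) \<inter> proj_zeros (lin x)"
      using v by (simp add: span_in_proj_zeros_iff)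
    then show ?thesis
      using assms False by (simp add: span_in_proj_zeros_iff)
  qed simp
qed

text \<open>On the hyperplane of \<open>x\<close>, the form of \<open>z\<close> is \<open>c\<close>
  times that of \<open>y\<close>.\<close>

lemma proj_zeros_Int_eqI:
  assumes "z - x = c *s (y - x)" and "c \<noteq> 0"
  shows "proj_zeros (lin y) \<inter> proj_zeros (lin x) = proj_zeros (lin z) \<inter> proj_zeros (lin x)"
proof -
  have "dot z v = dot x v + c * (dot y v - dot x v)" for v
    using arg_cong[OF assms(1), of "\<lambda>w. dot w v"] by (simp add: algebra_simps)
  then have "P \<in> proj_zeros (lin y) \<longleftrightarrow> P \<in> proj_zeros (lin z)" if "P \<in> proj_zeros (lin x)" for P
    using that assms(2) proj_zeros_cases[OF that] by (metis add_cancel_left_left diff_zero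
        mult_eq_0_iff span_in_proj_zeros_iff)
  then show ?thesis
    by blast
qed

section \<open>Normalised equations of an arrangement\<close>

lemma defining_form:
  assumes "defines_hyperplane l H"
  defines "b \<equiv> lin_coeffs (defining_form H)"
  shows "defining_form H = lin b" and "b \<noteq> 0" and "H = proj_zeros (lin b)"
proof -
  have "defines_hyperplane (defining_form H) H"
    unfolding defining_form_def using assms(1) by (rule someI)
  then have *: "defining_form H \<in> range lin" "defining_form H \<noteq> 0" "H = proj_zeros (defining_form H)"
    unfolding defines_hyperplane_def forms_1_eq by blast+
  then show lin_b: "defining_form H = lin b"
    unfolding b_def by (metis imageE lin_coeffs_lin)
  show "b \<noteq> 0"
    using *(2) lin_b by auto
  show "H = proj_zeros (lin b)"
    using *(3) lin_b by simp
qed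

text \<open>If the direction lies on the hyperplane, the inverse is 0 and so is this vector; a
  general direction excludes that case.\<close>

definition normal :: "('k::field, 'n::finite) mpoly \<Rightarrow> ('k, 'n) proj_point set \<Rightarrow> 'k ^ 'n" where
  "normal l H = inverse (dot (lin_coeffs (defining_form H)) (lin_coeffs l)) *s lin_coeffs (defining_form H)"

text \<open>Nonvanishing of the defining polynomial at the coefficients of \<open>l\<close> says
  that this direction lies on no hyperplane of \<open>A\<close>. This is the explicit open condition
  on \<open>l\<close>.\<close>

locale general_direction =
  fixes A :: "('k::field_char_0, 'n::finite) proj_point set set" and l :: "('k, 'n) mpoly"
  assumes finite_A: "finite A"
    and hyperplane: "\<And>H. H \<in> A \<Longrightarrow> \<exists>l. defines_hyperplane l H"
    and general: "eval_at (arr_poly A) (lin_coeffs l) \<noteq> 0"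
begin

abbreviation b :: "('k, 'n) proj_point set \<Rightarrow> 'k ^ 'n" where
  "b H \<equiv> lin_coeffs (defining_form H)"

lemma b:
  assumes "H \<in> A"
  shows "defining_form H = lin (b H)" and "b H \<noteq> 0" and "H = proj_zeros (lin (b H))"
  using defining_form hyperplane[OF assms] by blast+

lemma arr_poly_eq: "arr_poly A = (\<Prod>H\<in>A. lin (b H))"
  unfolding arr_poly_def using b(1) by (intro prod.cong) auto

lemma dot_b_nonzero: "H \<in> A \<Longrightarrow> dot (b H) (lin_coeffs l) \<noteq> 0"
proof -
  assume "H \<in> A"
  have "eval_at (arr_poly A) (lin_coeffs l) = (\<Prod>H\<in>A. eval_at (lin (b H)) (lin_coeffs l))"
    by (simp only: arr_poly_eq eval_at_eq_msubst id_hom.msubst_prod)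
  with general \<open>H \<in> A\<close> finite_A show ?thesis
    by auto
qed

lemma dot_normal: "H \<in> A \<Longrightarrow> dot (normal l H) (lin_coeffs l) = 1"
  by (simp add: normal_def dot_b_nonzero)

lemma proj_zeros_normal: "H \<in> A \<Longrightarrow> proj_zeros (lin (normal l H)) = H"
  using b(3) by (simp add: normal_def dot_b_nonzero proj_zeros_lin_scale)

lemma inj_on_normal: "inj_on (normal l) A"
  by (metis inj_onI proj_zeros_normal)

lemma residual_eq: "residual l A = log_residual (normal l) A"
proof -
  have "\<not> lin (b H) dvd lin (b H')" if H: "H \<in> A" "H' \<in> A" "H \<noteq> H'" for H H'
  proof
    assume "lin (b H) dvd lin (b H')"
    then obtain c where c: "b H' = c *s b H"
      using lin_dvd_lin_iff[OF b(2)[OF H(1)]] by blast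
    moreover from this have "c \<noteq> 0"
      using b(2)[OF H(2)] by auto
    ultimately have "proj_zeros (lin (b H')) = proj_zeros (lin (b H))"
      by (simp add: proj_zeros_lin_scale)
    then show False
      using H b(3) by metis
  qed
  then show ?thesis
    unfolding residual_def arr_poly_eq normal_def[abs_def]
    by (intro residual_iff_log_residual finite_A dot_b_nonzero) auto
qed

end

lemma eval_at_dvd_0: "f dvd g \<Longrightarrow> eval_at f v = 0 \<Longrightarrow> eval_at g v = 0"
  by (auto elim!: dvdE simp: eval_at_eq_msubst id_hom.msubst_mult)

text \<open>Primality of \<open>f\<close> lets \<open>g\<close> be cancelled modulo
  \<open>f\<close>, and the common zero \<open>v\<close> keeps 1 out of the ideal.\<close>

lemma regular_sequence_pair:
  fixes f g :: "('k::field, 'n::finite) mpoly"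
  assumes "prime_elem f" and "\<not> f dvd g" and "eval_at f v = 0" and "eval_at g v = 0"
  shows "regular_sequence [f, g]"
proof -
  have "1 \<notin> ideal_gen {f, g}"
  proof
    assume "1 \<in> ideal_gen {f, g}"
    then obtain s t where "1 = s * f + t * g"
      by (auto simp: in_ideal_gen_pair)
    then have "eval_at 1 v = eval_at (s * f + t * g) v"
      by (rule arg_cong)
    then show False
      using assms by (simp add: eval_at_eq_msubst id_hom.msubst_add id_hom.msubst_mult id_hom.msubst_one)
  qed
  then have "ideal_gen (set [f, g]) \<noteq> UNIV"
    by auto
  moreover have "h \<in> ideal_gen (set (take i [f, g]))"
    if i: "i < length [f, g]" and h: "h * [f, g] ! i \<in> ideal_gen (set (take i [f, g]))" for i h
  proof -
    consider "i = 0" | "i = 1"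
      using i by fastforce
    then show ?thesis
    proof cases
      case 1
      then have "h * f = 0"
        using h by simp
      then have "h = 0"
        using assms(1) mpoly_no_zero_divisors by force
      then show ?thesis
        by (simp add: ideal.span_zero)
    next
      case 2
      then have "f dvd h * g"
        using h by (simp add: in_ideal_gen_singleton)
      then have "f dvd h"
        using assms(1,2) by (simp add: prime_elem_dvd_mult_iff)
      with 2 show ?thesis
        by (simp add: in_ideal_gen_singleton)
    qed
  qed
  ultimately show ?thesis
    unfolding regular_sequence_def by blast
qed

theorem proposition8p1:
  fixes n :: nat
    and A :: "('k::field_char_0, 'n::finite) proj_point set set"
    and H :: "('k, 'n) proj_point set"
    and x :: "('k, 'n) mpoly"
  assumes "2 \<le> n" and "CARD('n) = n + 1"
    and "arrangement A"
    and "defines_hyperplane x H"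
    and "H \<notin> A"
    and "\<And>P P'. \<lbrakk>P \<in> pairwise_meets A; P' \<in> pairwise_meets A; P \<subseteq> H; P' \<subseteq> H\<rbrakk> \<Longrightarrow> P = P'"
  shows "for_general_linear_form (\<lambda>l. \<exists>p.
           p \<in> residual l A \<and>
           p \<in> forms (card (restriction A H)) \<and>
           regular_sequence [x, p] \<and>
           residual l (insert H A) = x *o residual l A + ideal_gen {p})"
proof -
  \<comment> \<open>The polynomial of the enlarged arrangement is used because its nonvanishing
    makes \<open>l\<close> general for both arrangements at once.\<close>
  let ?F = "arr_poly (insert H A)"
  let ?U = "{l \<in> forms 1. \<exists>g \<in> {?F}. eval_at g (lin_coeffs l) \<noteq> 0}"
  have finite_A: "finite A" and "A \<noteq> {}"
    using assms(3) by (auto simp: arrangement_def)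
  have hyperplane: "\<exists>l. defines_hyperplane l H'" if "H' \<in> insert H A" for H'
    using assms(3,4) that by (auto simp: arrangement_def)
  obtain v where v: "\<And>H'. H' \<in> insert H A \<Longrightarrow> dot (lin_coeffs (defining_form H')) v \<noteq> 0"
    using ex_common_nonzero[of "(\<lambda>H'. lin_coeffs (defining_form H')) ` insert H A"]
      finite_A hyperplane defining_form(2) by fastforce
  have "eval_at ?F v = (\<Prod>H'\<in>insert H A. eval_at (defining_form H') v)"
    by (simp only: arr_poly_def eval_at_eq_msubst id_hom.msubst_prod)
  also have "\<dots> \<noteq> 0"
  proof -
    have "eval_at (defining_form H') v \<noteq> 0" if "H' \<in> insert H A" for H'
      using v[OF that] hyperplane[OF that] by (metis defining_form(1) eval_at_lin)
    with finite_A show ?thesis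
      by (simp only: prod_zero_iff finite_insert) blast
  qed
  finally have "lin v \<in> ?U"
    by (simp add: forms_1_eq del: One_nat_def)
  moreover have "zariski_open_forms1 ?U"
    unfolding zariski_open_forms1_def by blast
  moreover have "\<exists>p. p \<in> residual l A \<and> p \<in> forms (card (restriction A H)) \<and> regular_sequence [x, p] \<and>
      residual l (insert H A) = x *o residual l A + ideal_gen {p}" if "l \<in> ?U" for l
  proof -
    interpret big: general_direction "insert H A" l
      by standard (use that finite_A hyperplane in auto)
    have "eval_at ?F (lin_coeffs l) = eval_at (defining_form H) (lin_coeffs l) * eval_at (arr_poly A) (lin_coeffs l)"
      using finite_A assms(5) by (simp add: arr_poly_def eval_at_eq_msubst id_hom.msubst_mult)
    then interpret small: general_direction A l
      by unfold_locales (use big.general finite_A hyperplane in auto)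
    let ?N = "normal l"
    \<comment> \<open>Two members with the same trace on \<open>H\<close> meet exactly in that
      trace, which turns repeated traces into elements of \<open>pairwise_meets A\<close> contained
      in \<open>H\<close>.\<close>
    have meet: "h \<inter> h' = h \<inter> H \<and> h \<inter> h' \<subseteq> H"
      if h: "h \<in> A" "h' \<in> A" "h \<noteq> h'" and eq: "h \<inter> H = h' \<inter> H" for h h'
    proof -
      have "proj_zeros (lin (?N h)) \<inter> proj_zeros (lin (?N H)) = proj_zeros (lin (?N h')) \<inter> proj_zeros (lin (?N H))"
        using h eq by (simp add: big.proj_zeros_normal)
      then obtain c d where cd: "?N h' = c *s ?N H + d *s ?N h"
        by (rule proj_zeros_Int_eqD)
      \<comment> \<open>Pairing with the direction gives \<open>c + d = 1\<close>, so
        \<open>c = 0\<close> would make the normals of \<open>h\<close> and \<open>h'\<close> equal.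
        With \<open>c\<close> nonzero, the form of \<open>H\<close> vanishes wherever those of
        \<open>h\<close> and \<open>h'\<close> both do.\<close>
      have "c \<noteq> 0"
      proof
        assume "c = 0"
        moreover from this have "d = 1"
          using arg_cong[OF cd, of "\<lambda>w. dot w (lin_coeffs l)"] h by (simp add: big.dot_normal)
        ultimately show False
          using cd h big.inj_on_normal by (auto simp: inj_on_def)
      qed
      have "P \<in> H" if P: "P \<in> h \<inter> h'" for P
      proof -
        have "P \<in> proj_zeros (lin (?N h))" "P \<in> proj_zeros (lin (?N h'))"
          using P h by (simp_all add: big.proj_zeros_normal)
        then obtain v where "v \<noteq> 0" "P = vec.span {v}" "dot (?N h) v = 0" "dot (?N h') v = 0"
          by (metis proj_zeros_cases span_in_proj_zeros_iff)
        then have "P \<in> proj_zeros (lin (?N H))"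
          using \<open>c \<noteq> 0\<close> by (simp add: span_in_proj_zeros_iff cd)
        then show ?thesis
          by (simp add: big.proj_zeros_normal)
      qed
      then show ?thesis
        using eq by blast
    qed
    have "\<exists>h0\<in>A. \<forall>h\<in>A. \<forall>h'\<in>A. h \<noteq> h' \<longrightarrow> h \<inter> H = h' \<inter> H \<longrightarrow> h \<inter> H = h0 \<inter> H"
    proof (cases "\<exists>h\<in>A. \<exists>h'\<in>A. h \<noteq> h' \<and> h \<inter> H = h' \<inter> H")
      case True
      then obtain h0 h0' where h0: "h0 \<in> A" "h0' \<in> A" "h0 \<noteq> h0'" "h0 \<inter> H = h0' \<inter> H"
        by blast
      have "h \<inter> H = h0 \<inter> H" if h: "h \<in> A" "h' \<in> A" "h \<noteq> h'" "h \<inter> H = h' \<inter> H" for h h'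
      proof -
        have "h \<inter> h' \<in> pairwise_meets A" "h0 \<inter> h0' \<in> pairwise_meets A"
          using h h0 by (auto simp: pairwise_meets_def)
        \<comment> \<open>Two repeated traces are both meets inside \<open>H\<close>, and the
          hypothesis allows only one of these.\<close>
        then have "h \<inter> h' = h0 \<inter> h0'"
          using meet[OF h] meet[OF h0] by (intro assms(6)) auto
        then show ?thesis
          using meet[OF h] meet[OF h0] by simp
      qed
      with h0(1) show ?thesis
        by (intro bexI[of _ h0] ballI impI)
    next
      case False
      \<comment> \<open>Without repeated traces every class is a singleton, and any member may serve
        as \<open>h0\<close>.\<close>
      obtain h0 where "h0 \<in> A"
        using \<open>A \<noteq> {}\<close> by auto
      with False show ?thesis
        by meson
    qed
    then obtain h0 where h0: "h0 \<in> A"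
      and unique: "\<forall>h\<in>A. \<forall>h'\<in>A. h \<noteq> h' \<longrightarrow> h \<inter> H = h' \<inter> H \<longrightarrow> h \<inter> H = h0 \<inter> H" ..
    define T where "T = {h \<in> A. h \<inter> H \<noteq> h0 \<inter> H}"
    have inj: "inj_on (\<lambda>h. h \<inter> H) (insert h0 T)"
    proof (rule inj_onI, rule ccontr)
      fix h h' assume h: "h \<in> insert h0 T" "h' \<in> insert h0 T" "h \<inter> H = h' \<inter> H" "h \<noteq> h'"
      then have "h \<inter> H = h0 \<inter> H"
        using unique h0 by (simp add: T_def) metis
      then show False
        using h by (auto simp: T_def)
    qed
    interpret hyperplane_addition ?N "lin_coeffs l" A T h0 H
    proof
      fix h
      assume h: "h \<in> A - T"
      then have "proj_zeros (lin (?N h0)) \<inter> proj_zeros (lin (?N H)) = proj_zeros (lin (?N h)) \<inter> proj_zeros (lin (?N H))"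
        using h0 by (simp add: big.proj_zeros_normal T_def)
      then obtain c d where cd: "?N h = c *s ?N H + d *s ?N h0"
        by (rule proj_zeros_Int_eqD)
      have "c + d = 1"
        using arg_cong[OF cd, of "\<lambda>w. dot w (lin_coeffs l)"] h h0 by (simp add: big.dot_normal)
      then have "?N h - ?N H = d *s (?N h0 - ?N H)"
        unfolding cd by (auto simp: vec_eq_iff algebra_simps simp flip: distrib_right)
      then show "\<exists>c. ?N h - ?N H = c *s (?N h0 - ?N H)" ..
    next
      fix h h' c
      assume h: "h \<in> insert h0 T" "h' \<in> insert h0 T" "h \<noteq> h'"
      then have hA: "h \<in> A" "h' \<in> A"
        using h0 by (auto simp: T_def)
      show "?N h' - ?N H \<noteq> c *s (?N h - ?N H)"
      proof
        assume *: "?N h' - ?N H = c *s (?N h - ?N H)"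
        have "?N h' \<noteq> ?N H"
          using hA assms(5) big.inj_on_normal by (metis inj_on_def insertCI)
        then have "c \<noteq> 0"
          using * by auto
        then have "h \<inter> H = h' \<inter> H"
          using proj_zeros_Int_eqI[OF *] hA by (simp add: big.proj_zeros_normal)
        then show False
          using inj h by (auto simp: inj_on_def)
      qed
    qed (use finite_A assms(5) h0 big.inj_on_normal big.dot_normal in \<open>auto simp: T_def\<close>)
    obtain \<xi> where \<xi>: "x = lin \<xi>" "\<xi> \<noteq> 0" "proj_zeros (lin \<xi>) = H"
      using assms(4) by (auto simp: defines_hyperplane_def forms_1_eq simp del: One_nat_def)
    then have "proj_zeros (lin (?N H)) = proj_zeros (lin \<xi>)"
      by (simp add: big.proj_zeros_normal)
    then obtain c where c: "\<xi> = c *s ?N H"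
      by (rule proj_zeros_lin_eqD)
    have "c \<noteq> 0"
      using c \<xi>(2) by auto
    have x: "x = Const c * lin (?N H)"
      by (simp add: \<xi>(1) c lin_scale)
    \<comment> \<open>The given form \<open>x\<close> and the normalised form of \<open>H\<close>
      differ by the unit \<open>c\<close>, which the residual absorbs because it is closed under
      multiplication.\<close>
    have x_times: "x *o residual l A = lin (?N H) *o residual l A"
    proof (intro equalityI subsetI)
      fix g assume "g \<in> x *o residual l A"
      then obtain r where "r \<in> residual l A" "g = lin (?N H) * (Const c * r)"
        by (auto simp: elt_set_times_def x ac_simps)
      then show "g \<in> lin (?N H) *o residual l A"
        unfolding small.residual_eq by (auto simp: elt_set_times_def intro: log_residual_mult)
    next
      fix g assume "g \<in> lin (?N H) *o residual l A"
      then obtain r where r: "r \<in> residual l A" "g = lin (?N H) * r"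
        by (auto simp: elt_set_times_def)
      then have "g = x * (Const (inverse c) * r)"
        using Const_mult_inverse[OF \<open>c \<noteq> 0\<close>, of g] by (simp add: x ac_simps)
      with r(1) show "g \<in> x *o residual l A"
        unfolding small.residual_eq by (auto simp: elt_set_times_def intro: log_residual_mult)
    qed
    \<comment> \<open>One representative of each trace remains in \<open>insert h0 T\<close>, so the
      degree of \<open>p\<close> counts the traces.\<close>
    have "restriction A H = (\<lambda>h. h \<inter> H) ` insert h0 T"
      using h0 by (auto simp: restriction_def T_def)
    then have card: "card (restriction A H) = card (insert h0 T)"
      using inj by (simp only: card_image)
    have "regular_sequence [x, p]"
    proof (rule regular_sequence_pair)
      show "prime_elem x"
        unfolding \<xi>(1) using \<xi>(2) by (rule prime_elem_lin)
      show "\<not> x dvd p"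
        unfolding \<xi>(1) c lin_scale_dvd_iff[OF \<open>c \<noteq> 0\<close>] by (rule N1_not_dvd_p)
      show "eval_at x 0 = 0"
        by (simp add: \<xi>(1))
      show "eval_at p 0 = 0"
        by (rule eval_at_dvd_0[of "lin (z h0)"]) (simp_all add: p_def)
    qed
    then show ?thesis
      using p_in_log_residual p_in_forms log_residual_insert card x_times
      by (auto simp: small.residual_eq big.residual_eq)
  qed
  ultimately show ?thesis
    unfolding for_general_linear_form_def by blast
qed

end
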